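(* For every integer $p \ge 0$ and every real $\nu \in [0,1]$, the polynomial $g_{p,p+\nu}$ is $\nu$-Hölder continuous on $[-1,1]$ with constant $$\tilde H_{p,\nu} := \begin{cases} H_{p,\nu}, & \text{if } p \text{ is even},\\ 2^{1-\nu} H_{p,\nu}, & \text{if } p \text{ is odd},\end{cases}$$ where $H_{p,\nu}$ is the $\nu$-Hölder constant of $g_{p,p+\nu}$ on $[0,1]$.
   Context: The polynomials $g_{p,q} : \mathbb{R} \to \mathbb{R}$ (integer $p \ge 0$, real $q$) are defined recursively by $g_{0,q}(\tau) := 1$ and, for $p \ge 1$, $g_{p,q}(\tau) := (1-\tau^2)\, g_{p-1,q}'(\tau) + (q-p+1)\,\tau\, g_{p-1,q}(\tau)$, where the prime denotes differentiation in $\tau$. A function $g$ is $\nu$-Hölder continuous on an interval $I$ with constant $C$ if $|g(\tau_2) - g(\tau_1)| \le C|\tau_2-\tau_1|^\nu$ for all distinct $\tau_1,\tau_2 \in I$. The $\nu$-Hölder constant of $g_{p,p+\nu}$ on $[0,1]$ is $$H_{p,\nu} := \sup_{0 \le \tau_1 < \tau_2 \le 1} \frac{g_{p,p+\nu}(\tau_2) - g_{p,p+\nu}(\tau_1)}{(\tau_2-\tau_1)^\nu}$$ (no absolute value is needed in the numerator because $g_{p,p+\nu}$ is nondecreasing on $[0,1]$). *)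

theory Defs
  imports Complex_Main "HOL-Computational_Algebra.Polynomial"
begin

text \<open>In the recursive clause the index of the paper is \<open>Suc p\<close>, so its coefficient
  \<open>q - p + 1\<close> is \<open>q - real (Suc p) + 1\<close> here; \<open>[:1, 0, -1:]\<close> is $1 - \tau^2$ and
  \<open>[:0, 1:]\<close> is $\tau$.\<close>

primrec g_poly :: "nat \<Rightarrow> real \<Rightarrow> real poly" where
  "g_poly 0 q = 1"
| "g_poly (Suc p) q =
     [:1, 0, -1:] * pderiv (g_poly p q)
     + smult (q - real (Suc p) + 1) ([:0, 1:] * g_poly p q)"

text \<open>The points are required to be distinct, so for \<open>\<nu> = 0\<close> the factor
  \<open>\<bar>\<tau>2 - \<tau>1\<bar> powr \<nu>\<close> is 1, and the convention \<open>0 powr 0 = 0\<close> plays no role.\<close>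

definition holder_continuous_with :: "real \<Rightarrow> real \<Rightarrow> (real \<Rightarrow> real) \<Rightarrow> real set \<Rightarrow> bool" where
  "holder_continuous_with \<nu> C f I \<longleftrightarrow>
     (\<forall>\<tau>1\<in>I. \<forall>\<tau>2\<in>I. \<tau>1 \<noteq> \<tau>2 \<longrightarrow> \<bar>f \<tau>2 - f \<tau>1\<bar> \<le> C * \<bar>\<tau>2 - \<tau>1\<bar> powr \<nu>)"

text \<open>The supremum is taken in the reals. For \<open>0 \<le> \<nu> \<le> 1\<close> it is a genuine one: the set is
  nonempty, and bounded above because a polynomial is Lipschitz on $[0,1]$ and
  \<open>\<tau>2 - \<tau>1 \<le> (\<tau>2 - \<tau>1) powr \<nu>\<close> for \<open>0 < \<tau>2 - \<tau>1 \<le> 1\<close>.\<close>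

definition holder_const :: "nat \<Rightarrow> real \<Rightarrow> real" where
  "holder_const p \<nu> =
     Sup {(poly (g_poly p (real p + \<nu>)) \<tau>2 - poly (g_poly p (real p + \<nu>)) \<tau>1)
            / (\<tau>2 - \<tau>1) powr \<nu> | \<tau>1 \<tau>2. 0 \<le> \<tau>1 \<and> \<tau>1 < \<tau>2 \<and> \<tau>2 \<le> 1}"

definition holder_const_sym :: "nat \<Rightarrow> real \<Rightarrow> real" where
  "holder_const_sym p \<nu> =
     (if even p then holder_const p \<nu> else 2 powr (1 - \<nu>) * holder_const p \<nu>)"

end

theory Submission
  imports Defs "HOL-Analysis.Convex"
begin

text \<open>
  The polynomial \<open>g_poly p q\<close> has the parity of \<open>p\<close>, so everything reduces to \<open>[0,1]\<close>, provided
  that \<open>g = g_poly p (p + \<nu>)\<close> is nondecreasing there: this is what makes the supremum of the signed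
  difference quotients a nonnegative bound for the absolute ones as well. Two points of equal
  sign are then covered by the definition of the supremum \<open>H\<close>. For two points \<open>-s < 0 < t\<close> of opposite
  sign and even \<open>p\<close>, the increment equals \<open>g t - g s\<close> while the distance only shrinks from
  \<open>t + s\<close> to \<open>\<bar>t - s\<bar>\<close>. For odd \<open>p\<close> we have \<open>g 0 = 0\<close>, and the increment \<open>g t + g s\<close> is at
  most \<open>H * (t powr \<nu> + s powr \<nu>)\<close>, so that concavity of \<open>x powr \<nu>\<close> produces the factor
  \<open>2 powr (1 - \<nu>)\<close>.

  Monotonicity comes from a second-order equation. Behind the recursion stands the identity that the
  \<open>p\<close>-th derivative of \<open>(1 + x\<^sup>2) powr (q/2)\<close> is \<open>(1 + x\<^sup>2) powr ((q-p)/2)\<close> times \<open>g_poly p q\<close> at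
  \<open>\<tau> = x / sqrt (1 + x\<^sup>2)\<close>, and \<open>g_poly p q\<close> solves the Gegenbauer-type equation
  \<open>(1 - \<tau>\<^sup>2) g'' + (q-1) \<tau> g' = p (q-p) g\<close> (lemma \<open>g_poly_ode_and_deriv\<close>). For \<open>q = p + \<nu>\<close> the
  factor \<open>p (q-p) = p \<nu>\<close> on the right is nonnegative, so in the self-adjoint form
  \<open>(w g')' = p \<nu> w g / (1 - \<tau>\<^sup>2)\<close> with a weight \<open>w > 0\<close>, a solution starting at \<open>0\<close> with
  nonnegative value and slope, not both zero, can neither change its sign nor start to decrease
  (lemma \<open>ode_solution_nondecreasing\<close>).
\<close>

section \<open>A differential equation for the polynomials\<close>

text \<open>Each of the two assertions for \<open>p\<close> feeds the other one: differentiating the recursion and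
  eliminating the second derivative by the equation for \<open>p\<close> gives the formula for the derivative of
  \<open>g_poly (Suc p) q\<close>; differentiating that formula once more gives the equation for \<open>Suc p\<close>.\<close>

lemma g_poly_ode_and_deriv:
  "[:1, 0, -1:] * pderiv (pderiv (g_poly p q)) + smult (q - 1) ([:0, 1:] * pderiv (g_poly p q))
     = smult (real p * (q - real p)) (g_poly p q) \<and>
   pderiv (g_poly (Suc p) q) =
     smult (real (Suc p)) (smult (q - real p) (g_poly p q) - [:0, 1:] * pderiv (g_poly p q))"
proof (induction p)
  have deriv_step: "pderiv (g_poly (Suc p) q) =
     smult (real (Suc p)) (smult (q - real p) (g_poly p q) - [:0, 1:] * pderiv (g_poly p q))"
    if ode: "[:1, 0, -1:] * pderiv (pderiv (g_poly p q))
               + smult (q - 1) ([:0, 1:] * pderiv (g_poly p q))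
             = smult (real p * (q - real p)) (g_poly p q)" for p
  proof (rule poly_eq_poly_eq_iff[THEN iffD1], rule ext)
    fix t :: real
    have "(1 - t^2) * poly (pderiv (pderiv (g_poly p q))) t + (q-1) * t * poly (pderiv (g_poly p q)) t
            = real p * (q - real p) * poly (g_poly p q) t"
      using arg_cong[OF ode, of "\<lambda>r. poly r t"] by (simp add: algebra_simps power2_eq_square)
    then show "poly (pderiv (g_poly (Suc p) q)) t = poly (smult (real (Suc p))
        (smult (q - real p) (g_poly p q) - [:0, 1:] * pderiv (g_poly p q))) t"
      by (simp add: pderiv_mult pderiv_add pderiv_minus pderiv_smult pderiv_pCons) algebra
  qed
  {
    case 0
    show ?case using deriv_step[of 0] by simp
  next
    case (Suc p)
    let ?g = "g_poly p q"
    have ode: "[:1, 0, -1:] * pderiv (pderiv ?g) + smult (q - 1) ([:0, 1:] * pderiv ?g)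
                 = smult (real p * (q - real p)) ?g"
      and deriv: "pderiv (g_poly (Suc p) q) =
        smult (real (Suc p)) (smult (q - real p) ?g - [:0, 1:] * pderiv ?g)"
      using Suc.IH by auto
    have "[:1, 0, -1:] * pderiv (pderiv (g_poly (Suc p) q))
            + smult (q - 1) ([:0, 1:] * pderiv (g_poly (Suc p) q))
          = smult (real (Suc p) * (q - real (Suc p))) (g_poly (Suc p) q)"
    proof (rule poly_eq_poly_eq_iff[THEN iffD1], rule ext)
      fix t :: real
      have "(1 - t^2) * poly (pderiv (pderiv ?g)) t + (q-1) * t * poly (pderiv ?g) t
              = real p * (q - real p) * poly ?g t"
        using arg_cong[OF ode, of "\<lambda>r. poly r t"] by (simp add: algebra_simps power2_eq_square)
      then show "poly ([:1, 0, -1:] * pderiv (pderiv (g_poly (Suc p) q))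
            + smult (q - 1) ([:0, 1:] * pderiv (g_poly (Suc p) q))) t
          = poly (smult (real (Suc p) * (q - real (Suc p))) (g_poly (Suc p) q)) t"
        unfolding deriv
        by (simp add: pderiv_mult pderiv_diff pderiv_minus pderiv_smult pderiv_pCons) algebra
    qed
    with deriv_step[of "Suc p"] show ?case by blast
  }
qed

lemma g_poly_ode:
  "(1 - t\<^sup>2) * poly (pderiv (pderiv (g_poly p q))) t + (q - 1) * t * poly (pderiv (g_poly p q)) t
     = real p * (q - real p) * poly (g_poly p q) t"
  using arg_cong[OF conjunct1[OF g_poly_ode_and_deriv], of "\<lambda>r. poly r t" p q]
  by (simp add: algebra_simps power2_eq_square)

lemma poly_pderiv_g_poly_Suc:
  "poly (pderiv (g_poly (Suc p) q)) t =
     real (Suc p) * ((q - real p) * poly (g_poly p q) t - t * poly (pderiv (g_poly p q)) t)"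
  by (simp add: conjunct2[OF g_poly_ode_and_deriv] del: g_poly.simps)

lemma g_poly_parity:
  "poly (g_poly p q) (- t) = (- 1) ^ p * poly (g_poly p q) t"
  "poly (pderiv (g_poly p q)) (- t) = - ((- 1) ^ p * poly (pderiv (g_poly p q)) t)"
proof (induction p)
  case 0
  {
    case 1 show ?case by simp
  next
    case 2 show ?case by simp
  }
next
  case (Suc p)
  {
    case 1 show ?case by (simp add: Suc.IH algebra_simps)
  next
    case 2 show ?case by (simp add: poly_pderiv_g_poly_Suc Suc.IH algebra_simps del: g_poly.simps)
  }
qed

lemma poly_g_poly_Suc_0: "poly (g_poly (Suc p) q) 0 = poly (pderiv (g_poly p q)) 0"
  by simp

lemma poly_g_poly_Suc_Suc_0:
  "poly (g_poly (Suc (Suc p)) q) 0 = real (Suc p) * (q - real p) * poly (g_poly p q) 0"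
  by (simp only: poly_g_poly_Suc_0 poly_pderiv_g_poly_Suc) simp

lemma g_poly_0_odd: "odd p \<Longrightarrow> poly (g_poly p q) 0 = 0"
  using g_poly_parity(1)[of p q 0] by simp

text \<open>The values at \<open>0\<close> for even index are products of the factors \<open>(r + 1) (q - r)\<close> with even
  \<open>r \<le> p - 2\<close>, all positive when \<open>p - 2 < q\<close>. The bound is wide enough for index \<open>p + 1\<close> at
  \<open>q = p + \<nu>\<close>, which is the slope at \<open>0\<close> for odd \<open>p\<close>.\<close>

lemma g_poly_0_even_pos: "even p \<Longrightarrow> real p < q + 2 \<Longrightarrow> 0 < poly (g_poly p q) 0"
proof (induction p rule: less_induct)
  case (less p)
  show ?case
  proof (cases "p = 0")
    case False
    then obtain r where r: "p = Suc (Suc r)"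
      using less.prems(1) by (metis even_Suc not0_implies_Suc odd_pos even_zero)
    then have "0 < poly (g_poly r q) 0" "real r < q"
      using less by auto
    then show ?thesis
      unfolding r poly_g_poly_Suc_Suc_0 by simp
  qed simp
qed

section \<open>Monotonicity on the unit interval\<close>

text \<open>With the integrating factor \<open>w = (1 - t\<^sup>2) powr (-a/2)\<close> the equation reads
  \<open>F' = c w u / (1 - t\<^sup>2)\<close> for \<open>F = w u'\<close>. Hence \<open>(u F)' = w u'\<^sup>2 + c w u\<^sup>2 / (1 - t\<^sup>2) \<ge> 0\<close>.
  As \<open>u F\<close> starts at a nonnegative value, \<open>u u' \<ge> 0\<close> and \<open>u\<^sup>2\<close> is nondecreasing. By the initial
  condition \<open>u\<close> is positive immediately to the right of \<open>0\<close>, so it can never return to \<open>0\<close>. But then \<open>F\<close> is nondecreasing as well, and \<open>u'\<close> stays nonnegative.\<close>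

lemma ode_solution_nondecreasing:
  fixes u u' u'' :: "real \<Rightarrow> real"
  assumes du: "\<And>t. (u has_real_derivative u' t) (at t)"
    and du': "\<And>t. (u' has_real_derivative u'' t) (at t)"
    and ode: "\<And>t. (1 - t\<^sup>2) * u'' t + a * t * u' t = c * u t"
    and c: "0 \<le> c" and init: "0 \<le> u 0" "0 \<le> u' 0" "0 < u 0 \<or> 0 < u' 0"
    and st: "0 \<le> s" "s \<le> t" "t \<le> 1"
  shows "u s \<le> u t"
proof -
  define w where "w = (\<lambda>t::real. (1 - t\<^sup>2) powr (- a / 2))"
  define F where "F = (\<lambda>t. w t * u' t)"
  have sq: "0 < 1 - x\<^sup>2" if "0 \<le> x" "x < 1" for x :: real
    using power_strict_mono[of x 1 2] that by simp
  have w_pos: "0 < w x" if "0 \<le> x" "x < 1" for x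
    using sq[OF that] by (simp add: w_def)
  have dw: "(w has_real_derivative w x * (a * x / (1 - x\<^sup>2))) (at x)" if "0 \<le> x" "x < 1" for x
  proof -
    have "((\<lambda>t::real. 1 - t\<^sup>2) has_real_derivative - (2 * x)) (at x)"
      by (auto intro!: derivative_eq_intros)
    from DERIV_powr[OF this sq[OF that] DERIV_const[of "- a / 2"]] show ?thesis
      unfolding w_def by (simp add: mult_ac)
  qed
  have dF: "(F has_real_derivative c * w x * u x / (1 - x\<^sup>2)) (at x)" if "0 \<le> x" "x < 1" for x
  proof -
    have "(F has_real_derivative w x * (a * x / (1 - x\<^sup>2)) * u' x + u'' x * w x) (at x)"
      unfolding F_def by (rule DERIV_mult[OF dw[OF that] du'])
    moreover have "w x * (a * x / (1 - x\<^sup>2)) * u' x + u'' x * w x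
        = w x * ((1 - x\<^sup>2) * u'' x + a * x * u' x) / (1 - x\<^sup>2)"
      using sq[OF that] by (simp add: field_simps)
    ultimately show ?thesis
      unfolding ode by (simp add: mult_ac)
  qed
  have uF_mono: "u 0 * F 0 \<le> u x * F x" if "0 \<le> x" "x < 1" for x
  proof (rule DERIV_nonneg_imp_nondecreasing[OF that(1), where f = "\<lambda>x. u x * F x"])
    fix y assume y: "0 \<le> y" "y \<le> x"
    then have y1: "y < 1" using that by simp
    have "((\<lambda>x. u x * F x) has_real_derivative u' y * F y + c * w y * u y / (1 - y\<^sup>2) * u y) (at y)"
      by (rule DERIV_mult[OF du dF[OF y(1) y1]])
    moreover have "0 \<le> u' y * F y"
      using w_pos[OF y(1) y1] by (auto simp: F_def zero_le_mult_iff mult_le_0_iff)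
    moreover have "0 \<le> c * w y * u y / (1 - y\<^sup>2) * u y"
    proof -
      have "c * w y * u y / (1 - y\<^sup>2) * u y = c * w y * (u y)\<^sup>2 / (1 - y\<^sup>2)"
        by (simp add: power2_eq_square)
      also have "0 \<le> \<dots>" using w_pos[OF y(1) y1] sq[OF y(1) y1] c by simp
      finally show ?thesis .
    qed
    ultimately show "\<exists>d. ((\<lambda>x. u x * F x) has_real_derivative d) (at y) \<and> 0 \<le> d"
      by (metis add_nonneg_nonneg)
  qed
  have w0: "w 0 = 1" by (simp add: w_def)
  have uu': "0 \<le> u x * u' x" if "0 \<le> x" "x < 1" for x
  proof -
    have "0 \<le> u 0 * F 0" using init by (simp add: F_def w0)
    then have "0 \<le> w x * (u x * u' x)"
      using uF_mono[OF that] by (simp add: F_def mult.left_commute)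
    then show ?thesis using w_pos[OF that] by (simp add: zero_le_mult_iff)
  qed
  have sq_mono: "(u x)\<^sup>2 \<le> (u y)\<^sup>2" if "0 \<le> x" "x \<le> y" "y < 1" for x y
  proof (rule DERIV_nonneg_imp_nondecreasing[OF that(2), where f = "\<lambda>x. (u x)\<^sup>2"])
    fix z assume z: "x \<le> z" "z \<le> y"
    have "((\<lambda>x. (u x)\<^sup>2) has_real_derivative 2 * (u z * u' z)) (at z)"
      by (auto intro!: derivative_eq_intros du)
    then show "\<exists>d. ((\<lambda>x. (u x)\<^sup>2) has_real_derivative d) (at z) \<and> 0 \<le> d"
      using uu'[of z] z that by auto
  qed
  have cont: "isCont u x" for x using du DERIV_isCont by blast
  \<comment> \<open>Losing positivity would require a zero, where the nondecreasing function \<open>u\<^sup>2\<close> would be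
    smaller than before.\<close>
  have pos_right: "0 < u y" if xy: "0 \<le> x" "x \<le> y" "y < 1" "0 < u x" for x y
  proof (rule ccontr)
    assume "\<not> 0 < u y"
    then obtain z where z: "x \<le> z" "z \<le> y" "u z = 0"
      using IVT2[of u y 0 x] xy cont by auto
    then show False using sq_mono[of x z] xy by auto
  qed
  have pos: "0 < u y" if y: "0 < y" "y < 1" for y
  proof (cases "0 < u 0")
    case True
    then show ?thesis using pos_right[of 0 y] y by simp
  next
    case False
    then have "u 0 = 0" "0 < u' 0" using init by auto
    then obtain d where d: "0 < d" "\<And>h. 0 < h \<Longrightarrow> h < d \<Longrightarrow> u 0 < u (0 + h)"
      using DERIV_pos_inc_right[OF du] by metis
    define x where "x = min (d / 2) y"
    have "0 < u x" "0 \<le> x" "x \<le> y" using d(2)[of x] \<open>u 0 = 0\<close> d(1) y by (auto simp: x_def)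
    then show ?thesis using pos_right[of x y] y by simp
  qed
  have nonneg: "0 \<le> u y" if "0 \<le> y" "y < 1" for y
    using pos[of y] init(1) that by (cases "y = 0") auto
  have u'_nonneg: "0 \<le> u' x" if "0 \<le> x" "x < 1" for x
  proof -
    have "F 0 \<le> F x"
    proof (rule DERIV_nonneg_imp_nondecreasing[OF that(1)])
      fix y assume y: "0 \<le> y" "y \<le> x"
      then have y1: "y < 1" using that by simp
      show "\<exists>d. (F has_real_derivative d) (at y) \<and> 0 \<le> d"
        using dF[OF y(1) y1] nonneg[OF y(1) y1] w_pos[OF y(1) y1] sq[OF y(1) y1] c
        by (intro exI[of _ "c * w y * u y / (1 - y\<^sup>2)"]) simp
    qed
    moreover have "0 \<le> F 0" using init by (simp add: F_def w0)
    ultimately have "0 \<le> w x * u' x" by (simp add: F_def)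
    then show ?thesis using w_pos[OF that] by (simp add: zero_le_mult_iff)
  qed
  show ?thesis
  proof (rule DERIV_nonneg_imp_increasing_open[OF st(2)])
    show "\<exists>d. (u has_real_derivative d) (at x) \<and> 0 \<le> d" if "s < x" "x < t" for x
      using du u'_nonneg[of x] that st by auto
    show "continuous_on {s..t} u" using cont by (simp add: continuous_at_imp_continuous_on)
  qed
qed

lemma g_poly_nondecreasing:
  assumes "0 \<le> \<nu>" and st: "0 \<le> s" "s \<le> t" "t \<le> 1"
  shows "poly (g_poly p (real p + \<nu>)) s \<le> poly (g_poly p (real p + \<nu>)) t"
proof (rule ode_solution_nondecreasing[OF _ _ _ _ _ _ _ st])
  let ?g = "g_poly p (real p + \<nu>)"
  show "(poly ?g has_real_derivative poly (pderiv ?g) x) (at x)"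
    and "(poly (pderiv ?g) has_real_derivative poly (pderiv (pderiv ?g)) x) (at x)" for x
    by (rule poly_DERIV)+
  show "(1 - x\<^sup>2) * poly (pderiv (pderiv ?g)) x + (real p + \<nu> - 1) * x * poly (pderiv ?g) x
          = (real p * \<nu>) * poly ?g x" for x
    using g_poly_ode[of x p "real p + \<nu>"] by simp
  show "0 \<le> real p * \<nu>" using assms(1) by simp
  \<comment> \<open>The slope at \<open>0\<close> is the value at \<open>0\<close> of the next polynomial with the same \<open>q\<close>.\<close>
  have slope: "poly (pderiv ?g) 0 = poly (g_poly (Suc p) (real p + \<nu>)) 0"
    by simp
  have "if even p then 0 < poly ?g 0 \<and> poly (pderiv ?g) 0 = 0
        else poly ?g 0 = 0 \<and> 0 < poly (pderiv ?g) 0"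
    unfolding slope
    using g_poly_0_odd[of p "real p + \<nu>"] g_poly_0_odd[of "Suc p" "real p + \<nu>"]
      g_poly_0_even_pos[of p "real p + \<nu>"] g_poly_0_even_pos[of "Suc p" "real p + \<nu>"] assms(1)
    by (simp del: g_poly.simps)
  then show "0 \<le> poly ?g 0" "0 \<le> poly (pderiv ?g) 0" "0 < poly ?g 0 \<or> 0 < poly (pderiv ?g) 0"
    by (auto split: if_splits)
qed

section \<open>Extending a Hoelder bound by symmetry\<close>

lemma holder_continuous_withI_less:
  assumes "\<And>x y. x \<in> I \<Longrightarrow> y \<in> I \<Longrightarrow> x < y \<Longrightarrow> \<bar>f y - f x\<bar> \<le> C * (y - x) powr \<nu>"
  shows "holder_continuous_with \<nu> C f I"
  unfolding holder_continuous_with_def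
proof (intro ballI impI)
  fix x y assume "x \<in> I" "y \<in> I" "x \<noteq> y"
  then show "\<bar>f y - f x\<bar> \<le> C * \<bar>y - x\<bar> powr \<nu>"
    using assms[of x y] assms[of y x] by (cases "x < y") (auto simp: abs_minus_commute)
qed

lemma holder_continuous_withD:
  assumes "holder_continuous_with \<nu> C f I" "x \<in> I" "y \<in> I" "x \<noteq> y"
  shows "\<bar>f y - f x\<bar> \<le> C * \<bar>y - x\<bar> powr \<nu>"
  using assms by (auto simp: holder_continuous_with_def)

lemma holder_extend_even:
  fixes f :: "real \<Rightarrow> real"
  assumes H: "holder_continuous_with \<nu> C f {0..1}" and even: "\<And>t. f (- t) = f t"
    and C: "0 \<le> C" and \<nu>: "0 \<le> \<nu>"
  shows "holder_continuous_with \<nu> C f {-1..1}"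
  unfolding holder_continuous_with_def
proof (intro ballI impI)
  fix x y :: real assume xy: "x \<in> {-1..1}" "y \<in> {-1..1}" "x \<noteq> y"
  have f_abs: "f \<bar>z\<bar> = f z" for z using even by (simp add: abs_if)
  show "\<bar>f y - f x\<bar> \<le> C * \<bar>y - x\<bar> powr \<nu>"
  proof (cases "\<bar>x\<bar> = \<bar>y\<bar>")
    case True
    then have "f y = f x" using f_abs by metis
    then show ?thesis using C by simp
  next
    case False
    have "\<bar>f y - f x\<bar> \<le> C * \<bar>\<bar>y\<bar> - \<bar>x\<bar>\<bar> powr \<nu>"
      using holder_continuous_withD[OF H, of "\<bar>x\<bar>" "\<bar>y\<bar>"] xy False by (auto simp: f_abs)
    also have "\<dots> \<le> C * \<bar>y - x\<bar> powr \<nu>"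
      using C \<nu> by (intro mult_left_mono powr_mono2) auto
    finally show ?thesis .
  qed
qed

text \<open>This is concavity of \<open>x powr \<nu>\<close> at the midpoint of \<open>s\<close> and \<open>t\<close>, obtained from
  \<open>z powr \<nu> * 1 powr (1 - \<nu>) \<le> \<nu> * z + (1 - \<nu>)\<close> for the normalised values \<open>2s/(s+t)\<close> and
  \<open>2t/(s+t)\<close>, whose sum is \<open>2\<close>.\<close>

lemma powr_add_le_two_powr:
  fixes s t \<nu> :: real
  assumes \<nu>: "0 \<le> \<nu>" "\<nu> \<le> 1" and pos: "0 < s" "0 < t"
  shows "s powr \<nu> + t powr \<nu> \<le> 2 powr (1 - \<nu>) * (s + t) powr \<nu>"
proof -
  define m where "m = (s + t) / 2"
  have m: "0 < m" using pos by (simp add: m_def)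
  have young: "z powr \<nu> \<le> (\<nu> * (z / m) + (1 - \<nu>)) * m powr \<nu>" if "0 < z" for z
  proof -
    have "(z / m) powr \<nu> \<le> \<nu> * (z / m) + (1 - \<nu>)"
      using Youngs_inequality_0[of \<nu> "1 - \<nu>" "z / m" 1] \<nu> that m by simp
    then show ?thesis using that m by (simp add: powr_divide divide_le_eq)
  qed
  have "s powr \<nu> + t powr \<nu> \<le> (\<nu> * ((s + t) / m) + 2 * (1 - \<nu>)) * m powr \<nu>"
    using young[OF pos(1)] young[OF pos(2)] by (simp add: algebra_simps add_divide_distrib)
  also have "(s + t) / m = 2" using m by (simp add: m_def field_simps)
  also have "(\<nu> * 2 + 2 * (1 - \<nu>)) * m powr \<nu> = 2 powr (1 - \<nu>) * (s + t) powr \<nu>"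
    using pos by (simp add: m_def powr_divide powr_diff)
  finally show ?thesis .
qed

lemma holder_extend_odd:
  fixes f :: "real \<Rightarrow> real"
  assumes H: "holder_continuous_with \<nu> C f {0..1}" and odd: "\<And>t. f (- t) = - f t"
    and C: "0 \<le> C" and \<nu>: "0 \<le> \<nu>" "\<nu> \<le> 1"
  shows "holder_continuous_with \<nu> (2 powr (1 - \<nu>) * C) f {-1..1}"
proof (rule holder_continuous_withI_less)
  fix x y :: real assume xy: "x \<in> {-1..1}" "y \<in> {-1..1}" "x < y"
  have f0: "f 0 = 0" using odd[of 0] by simp
  have "(1::real) \<le> 2 powr (1 - \<nu>)" using \<nu> by (simp add: ge_one_powr_ge_zero)
  then have weaken: "C * (y - x) powr \<nu> \<le> 2 powr (1 - \<nu>) * C * (y - x) powr \<nu>"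
    using C mult_right_mono[of 1 "2 powr (1 - \<nu>)" "C * (y - x) powr \<nu>"] by (simp add: mult.assoc)
  consider "0 \<le> x" | "y \<le> 0" | "x < 0" "0 < y" by linarith
  then show "\<bar>f y - f x\<bar> \<le> 2 powr (1 - \<nu>) * C * (y - x) powr \<nu>"
  proof cases
    case 1
    then show ?thesis using holder_continuous_withD[OF H, of x y] weaken xy by auto
  next
    case 2
    then have "\<bar>f (- x) - f (- y)\<bar> \<le> C * \<bar>- x - (- y)\<bar> powr \<nu>"
      using xy by (intro holder_continuous_withD[OF H]) auto
    then show ?thesis using weaken xy by (simp add: odd)
  next
    case 3
    have "\<bar>f y\<bar> \<le> C * y powr \<nu>"
      using holder_continuous_withD[OF H, of 0 y] 3 xy f0 by auto
    moreover have "\<bar>f x\<bar> \<le> C * (- x) powr \<nu>"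
      using holder_continuous_withD[OF H, of 0 "- x"] 3 xy f0 by (auto simp: odd)
    ultimately have "\<bar>f y - f x\<bar> \<le> C * (y powr \<nu> + (- x) powr \<nu>)"
      by (simp add: distrib_left)
    also have "\<dots> \<le> C * (2 powr (1 - \<nu>) * (y + - x) powr \<nu>)"
      using 3 by (intro mult_left_mono[OF powr_add_le_two_powr] C \<nu>) auto
    finally show ?thesis by (simp add: mult_ac)
  qed
qed

section \<open>The Hoelder constant on the unit interval\<close>

text \<open>On an interval of length at most one a Lipschitz bound is a Hoelder bound for every exponent in
  \<open>[0,1]\<close>, since \<open>d \<le> d powr \<nu>\<close> for \<open>0 < d \<le> 1\<close>. So the supremum over the difference quotients is
  taken over a bounded set.\<close>

lemma poly_difference_quotients_bdd_above:
  fixes g :: "real poly"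
  assumes \<nu>: "\<nu> \<le> 1"
  shows "bdd_above {(poly g y - poly g x) / (y - x) powr \<nu> | x y. 0 \<le> x \<and> x < y \<and> y \<le> 1}"
proof -
  have "\<exists>M\<in>{0..1}. \<forall>z\<in>{0..1}. \<bar>poly (pderiv g) z\<bar> \<le> \<bar>poly (pderiv g) M\<bar>"
    by (rule continuous_attains_sup) (auto intro!: continuous_intros)
  then obtain B where B: "0 \<le> B" "\<And>z. 0 \<le> z \<Longrightarrow> z \<le> 1 \<Longrightarrow> \<bar>poly (pderiv g) z\<bar> \<le> B"
    by (metis abs_ge_zero atLeastAtMost_iff)
  have "(poly g y - poly g x) / (y - x) powr \<nu> \<le> B" if xy: "0 \<le> x" "x < y" "y \<le> 1" for x y
  proof -
    obtain z where z: "x < z" "z < y" "poly g y - poly g x = (y - x) * poly (pderiv g) z"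
      using poly_MVT[OF xy(2)] by blast
    have "poly g y - poly g x \<le> (y - x) * B"
      unfolding z(3) using B(2)[of z] z xy by (intro mult_left_mono) auto
    also have "\<dots> \<le> (y - x) powr \<nu> * B"
      using powr_mono'[OF \<nu>, of "y - x"] B(1) xy by (intro mult_right_mono) auto
    finally show ?thesis using xy by (simp add: divide_le_eq mult.commute)
  qed
  then show ?thesis by (intro bdd_aboveI[where M = B]) auto
qed

lemma g_poly_increment_le_holder_const:
  assumes "\<nu> \<le> 1" "0 \<le> x" "x < y" "y \<le> 1"
  shows "poly (g_poly p (real p + \<nu>)) y - poly (g_poly p (real p + \<nu>)) x
           \<le> holder_const p \<nu> * (y - x) powr \<nu>"
proof -
  have "(poly (g_poly p (real p + \<nu>)) y - poly (g_poly p (real p + \<nu>)) x) / (y - x) powr \<nu>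
          \<le> holder_const p \<nu>"
    unfolding holder_const_def
    using assms by (intro cSup_upper poly_difference_quotients_bdd_above) auto
  then show ?thesis using assms by (simp add: divide_le_eq)
qed

lemma holder_const_nonneg:
  assumes "0 \<le> \<nu>" "\<nu> \<le> 1"
  shows "0 \<le> holder_const p \<nu>"
  using g_poly_increment_le_holder_const[of \<nu> 0 1 p] g_poly_nondecreasing[of \<nu> 0 1 p] assms by simp

lemma g_poly_holder_unit_interval:
  assumes "0 \<le> \<nu>" "\<nu> \<le> 1"
  shows "holder_continuous_with \<nu> (holder_const p \<nu>) (poly (g_poly p (real p + \<nu>))) {0..1}"
proof (rule holder_continuous_withI_less)
  fix x y :: real assume "x \<in> {0..1}" "y \<in> {0..1}" "x < y"
  then show "\<bar>poly (g_poly p (real p + \<nu>)) y - poly (g_poly p (real p + \<nu>)) x\<bar>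
               \<le> holder_const p \<nu> * (y - x) powr \<nu>"
    using g_poly_nondecreasing[OF assms(1), of x y p]
      g_poly_increment_le_holder_const[OF assms(2), of x y p] by auto
qed

theorem theorem5p1:
  fixes p :: nat and \<nu> :: real
  assumes "0 \<le> \<nu>" and "\<nu> \<le> 1"
  shows "holder_continuous_with \<nu> (holder_const_sym p \<nu>) (poly (g_poly p (real p + \<nu>))) {-1..1}"
proof (cases "even p")
  case True
  then show ?thesis
    using holder_extend_even[OF g_poly_holder_unit_interval[OF assms] _ holder_const_nonneg]
      g_poly_parity(1)[of p "real p + \<nu>"] assms
    by (simp add: holder_const_sym_def)
next
  case False
  then show ?thesis
    using holder_extend_odd[OF g_poly_holder_unit_interval[OF assms] _ holder_const_nonneg]
      g_poly_parity(1)[of p "real p + \<nu>"] assms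
    by (simp add: holder_const_sym_def)
qed

end
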